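(* Let $d\ge2$. The set $\mathcal{P}_{\mathcal{W}_d}^s=\{\gamma\in\mathcal{P}_{\mathcal{W}_d}:\gamma((0,r))>0\text{ for every }r>0\}$ is co-meager in $\mathcal{P}_{\mathcal{W}_d}$ with respect to the weak topology. Moreover, the set $\mathcal{C}_{ar,s}^d$ of all strict $d$-dimensional Archimedean copulas is co-meager in $(\mathcal{C}_{ar}^d,d_\infty)$.
   Context: Notation: $\mathbb{I}=[0,1]$; $\inf\emptyset=\infty$. The uniform metric is $d_\infty(A,B)=\sup_{\mathbf{x}\in\mathbb{I}^d}|A(\mathbf{x})-B(\mathbf{x})|$. A subset of a topological space is meager if it can be covered by countably many nowhere dense sets, and co-meager if its complement is meager. A generator is a continuous non-increasing $\psi:[0,\infty)\to\mathbb{I}$ with $\psi(0)=1$, $\psi(\infty):=\lim_{z\to\infty}\psi(z)=0$, strictly decreasing on $[0,\inf\{x:\psi(x)=0\})$; its pseudo-inverse is $\varphi(y)=\inf\{z\in[0,\infty]:\psi(z)=y\}$, $y\in\mathbb{I}$. All generators are normalized by $\psi(1)=\frac12$. A generator is strict if $\varphi(0)=\infty$, equivalently $\psi(z)>0$ for all $z\ge0$. $\mathcal{C}_{ar}^d$ is the set of $d$-dimensional Archimedean copulas, i.e. copulas of the form $C(\mathbf{x})=\psi(\sum_{i=1}^d\varphi(x_i))$ (this function is a copula iff $\psi$ is $d$-monotone, i.e., with $\psi$ continuous on $[0,\infty)$, on $(0,\infty)$ $\psi$ is differentiable up to order $d-2$, $(-1)^k\psi^{(k)}\ge0$ for $k\le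 d-2$, and $(-1)^{d-2}\psi^{(d-2)}$ is non-increasing and convex). An Archimedean copula is strict if its (normalized) generator is strict. $\mathcal{P}_{\mathcal{W}_d}$ is the set of Borel probability measures $\gamma$ on $[0,\infty)$ with $\gamma(\{0\})=0$ and $\int_{[0,1]}(1-t)^{d-1}d\gamma(t)=\frac12$. It corresponds bijectively to $\mathcal{C}_{ar}^d$ via $\psi(z)=\int_{[0,\infty)}(1-tz)_+^{d-1}d\gamma(t)$. *)

theory Defs
  imports "HOL-Probability.Probability"
begin

section \<open>Meager and co-meager sets\<close>

definition nowhere_dense_in :: "'a topology \<Rightarrow> 'a set \<Rightarrow> bool" where
  "nowhere_dense_in X S \<longleftrightarrow> S \<subseteq> topspace X \<and> X interior_of (X closure_of S) = {}"

definition meager_in :: "'a topology \<Rightarrow> 'a set \<Rightarrow> bool" where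
  "meager_in X S \<longleftrightarrow> S \<subseteq> topspace X \<and>
     (\<exists>\<N>. countable \<N> \<and> (\<forall>N\<in>\<N>. nowhere_dense_in X N) \<and> S \<subseteq> \<Union>\<N>)"

definition comeager_in :: "'a topology \<Rightarrow> 'a set \<Rightarrow> bool" where
  "comeager_in X S \<longleftrightarrow> S \<subseteq> topspace X \<and> meager_in X (topspace X - S)"


section \<open>Borel probability measures and the weak topology\<close>

definition borel_probs :: "'a::topological_space set \<Rightarrow> 'a measure set" where
  "borel_probs S = {M. prob_space M \<and> sets M = sets (restrict_space borel S)}"

text \<open>The coarsest topology on the Borel probability measures on \<open>S\<close> for which
  \<open>M \<mapsto> \<integral>f dM\<close> is continuous for every bounded continuous \<open>f : S \<rightarrow> \<real>\<close>.\<close>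

definition weak_topology :: "'a::topological_space set \<Rightarrow> 'a measure topology" where
  "weak_topology S = topology_generated_by
     {{M \<in> borel_probs S. (LINT x|M. f x) \<in> U} | (f :: 'a \<Rightarrow> real) U.
        continuous_on S f \<and> bounded (f ` S) \<and> open U}"

lemma topspace_weak_topology: "topspace (weak_topology S) = borel_probs S"
proof -
  let ?B = "{{M \<in> borel_probs S. (LINT x|M. f x) \<in> U} | (f :: 'a \<Rightarrow> real) U.
        continuous_on S f \<and> bounded (f ` S) \<and> open U}"
  have "bounded ((\<lambda>_. 0 :: real) ` S)"
    by (rule finite_imp_bounded, rule finite_subset[of _ "{0}"]) auto
  then have "borel_probs S \<in> ?B"
    by (intro CollectI exI[of _ "\<lambda>_. 0"] exI[of _ UNIV]) auto
  then have "\<Union>?B = borel_probs S"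
    by blast
  then show ?thesis
    by (simp add: weak_topology_def)
qed

text \<open>The mixing measures of the Williamson transform; \<open>P_W_s\<close> adds that there is mass
  arbitrarily close to \<open>0\<close>.\<close>

definition P_W :: "nat \<Rightarrow> real measure set" where
  "P_W d = {\<gamma> \<in> borel_probs {0..}.
     measure \<gamma> {0} = 0 \<and> (LINT t:{0..1}|\<gamma>. (1 - t) ^ (d - 1)) = 1 / 2}"

definition P_W_s :: "nat \<Rightarrow> real measure set" where
  "P_W_s d = {\<gamma> \<in> P_W d. \<forall>r>0. measure \<gamma> {0<..<r} > 0}"


section \<open>Copulas\<close>

definition unit_cube :: "nat \<Rightarrow> (nat \<Rightarrow> real) set" where
  "unit_cube d = PiE {..<d} (\<lambda>_. {0..1})"

text \<open>The volume that \<open>C\<close> assigns to the box with lower corner \<open>a\<close> and upper corner \<open>b\<close>: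
  a corner is determined by the set \<open>S\<close> of coordinates taken from \<open>a\<close>.\<close>

definition box_volume :: "nat \<Rightarrow> ((nat \<Rightarrow> real) \<Rightarrow> real) \<Rightarrow> (nat \<Rightarrow> real) \<Rightarrow> (nat \<Rightarrow> real) \<Rightarrow> real" where
  "box_volume d C a b =
     (\<Sum>S\<in>Pow {..<d}. (- 1) ^ card S * C (\<lambda>i\<in>{..<d}. if i \<in> S then a i else b i))"

text \<open>A copula is an extensional function on the cube (\<open>undefined\<close> outside), so that equality
  of copulas is equality on the cube.\<close>

definition copula :: "nat \<Rightarrow> ((nat \<Rightarrow> real) \<Rightarrow> real) \<Rightarrow> bool" where
  "copula d C \<longleftrightarrow>
     C \<in> unit_cube d \<rightarrow>\<^sub>E {0..1} \<and>
     (\<forall>x\<in>unit_cube d. (\<exists>i<d. x i = 0) \<longrightarrow> C x = 0) \<and>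
     (\<forall>i<d. \<forall>u\<in>{0..1}. C (\<lambda>j\<in>{..<d}. if j = i then u else 1) = u) \<and>
     (\<forall>a\<in>unit_cube d. \<forall>b\<in>unit_cube d. (\<forall>i<d. a i \<le> b i) \<longrightarrow> 0 \<le> box_volume d C a b)"


section \<open>Archimedean copulas\<close>

text \<open>Only the values of \<open>\<psi>\<close> on \<open>[0,\<infinity>)\<close> matter. The infimum is taken in \<open>[0,\<infinity>]\<close>, so it is
  \<open>\<infinity>\<close> if \<open>\<psi>\<close> has no zero.\<close>

definition generator :: "(real \<Rightarrow> real) \<Rightarrow> bool" where
  "generator \<psi> \<longleftrightarrow>
     \<psi> ` {0..} \<subseteq> {0..1} \<and> continuous_on {0..} \<psi> \<and> antimono_on {0..} \<psi> \<and>
     \<psi> 0 = 1 \<and> (\<psi> \<longlongrightarrow> 0) at_top \<and>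
     strict_antimono_on {z. 0 \<le> z \<and> ennreal z < (INF x\<in>{x. 0 \<le> x \<and> \<psi> x = 0}. ennreal x)} \<psi>"

definition normalized_generator :: "(real \<Rightarrow> real) \<Rightarrow> bool" where
  "normalized_generator \<psi> \<longleftrightarrow> generator \<psi> \<and> \<psi> 1 = 1 / 2"

text \<open>The extension of a generator to \<open>[0,\<infinity>]\<close> by its limit \<open>\<psi>(\<infinity>) = 0\<close>.\<close>

definition gen_ext :: "(real \<Rightarrow> real) \<Rightarrow> ennreal \<Rightarrow> real" where
  "gen_ext \<psi> z = (if z = \<infinity> then 0 else \<psi> (enn2real z))"

definition pseudo_inverse :: "(real \<Rightarrow> real) \<Rightarrow> real \<Rightarrow> ennreal" where
  "pseudo_inverse \<psi> y = Inf {z. gen_ext \<psi> z = y}"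

definition strict_generator :: "(real \<Rightarrow> real) \<Rightarrow> bool" where
  "strict_generator \<psi> \<longleftrightarrow> pseudo_inverse \<psi> 0 = \<infinity>"

definition arch_fun :: "nat \<Rightarrow> (real \<Rightarrow> real) \<Rightarrow> (nat \<Rightarrow> real) \<Rightarrow> real" where
  "arch_fun d \<psi> = (\<lambda>x\<in>unit_cube d. gen_ext \<psi> (\<Sum>i<d. pseudo_inverse \<psi> (x i)))"

definition arch_copulas :: "nat \<Rightarrow> ((nat \<Rightarrow> real) \<Rightarrow> real) set" where
  "arch_copulas d = {C. copula d C \<and> (\<exists>\<psi>. normalized_generator \<psi> \<and> C = arch_fun d \<psi>)}"

definition strict_arch_copulas :: "nat \<Rightarrow> ((nat \<Rightarrow> real) \<Rightarrow> real) set" where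
  "strict_arch_copulas d =
     {C. copula d C \<and> (\<exists>\<psi>. normalized_generator \<psi> \<and> strict_generator \<psi> \<and> C = arch_fun d \<psi>)}"

text \<open>The metric space of Archimedean copulas with the uniform metric \<open>d\<^sub>\<infinity>\<close>; the two lemmas
  below unfold the library's notion of uniform metric on bounded functions.\<close>

definition arch_copula_metric :: "nat \<Rightarrow> ((nat \<Rightarrow> real) \<Rightarrow> real) metric" where
  "arch_copula_metric d = submetric (funspace (unit_cube d) euclidean_metric) (arch_copulas d)"

lemma arch_copulas_subset_fspace: "arch_copulas d \<subseteq> Met_TC.fspace (unit_cube d)"
proof
  fix C assume "C \<in> arch_copulas d"
  then have C: "C \<in> unit_cube d \<rightarrow>\<^sub>E {0..1}"
    by (simp add: arch_copulas_def copula_def)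
  have "bounded (C ` unit_cube d)"
    by (rule bounded_subset[OF bounded_closed_interval[of 0 1]]) (use C in auto)
  then show "C \<in> Met_TC.fspace (unit_cube d)"
    using C by (auto simp: Met_TC.fspace_def PiE_iff)
qed

lemma mspace_arch_copula_metric: "mspace (arch_copula_metric d) = arch_copulas d"
  using arch_copulas_subset_fspace[of d] by (auto simp: arch_copula_metric_def)

lemma mdist_arch_copula_metric:
  assumes "A \<in> arch_copulas d" "B \<in> arch_copulas d"
  shows "mdist (arch_copula_metric d) A B = (SUP x\<in>unit_cube d. \<bar>A x - B x\<bar>)"
proof -
  have "unit_cube d \<noteq> {}"
    by (simp add: unit_cube_def PiE_eq_empty_iff)
  then show ?thesis
    using assms arch_copulas_subset_fspace[of d]
    by (auto simp: arch_copula_metric_def Met_TC.fdist_def dist_real_def subset_iff)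
qed

end

theory Submission
  imports Defs
begin

text \<open>Both complements are countable unions of zero sets of continuous functions: of
  \<open>\<gamma> \<mapsto> \<integral> max 0 (1/k - t) d\<gamma>(t)\<close> for measures, and of \<open>C \<mapsto> C(1/k, \<dots>, 1/k)\<close> for copulas,
  since an Archimedean copula is strict iff it is positive on \<open>(0,1]\<^sup>d\<close>. Such a zero set is nowhere
  dense once every point is a limit of points outside it. The limits come from convexity: a measure
  is mixed with a two-point measure charging a small interval at \<open>0\<close>, and a generator with
  \<open>z \<mapsto> 2\<^sup>-\<^sup>z\<close>. For the latter, being a copula is expressed through alternating differences of the
  generator, which avoids derivatives and the Williamson transform; the second-order differences
  make \<open>\<psi> \<mapsto> C\<close> Lipschitz for the uniform metrics.\<close>

section \<open>A criterion for co-meager sets\<close>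

text \<open>Each zero set of \<open>f k\<close> is closed, hence equal to its closure. If it had an
  interior point, the sequence approximating that point would eventually enter the zero set,
  although \<open>f k\<close> never vanishes along it.\<close>

lemma comeager_inI:
  fixes f :: "nat \<Rightarrow> 'a \<Rightarrow> real"
  assumes "S \<subseteq> topspace X"
    and cont: "\<And>k. continuous_map X euclideanreal (f k)"
    and dense: "\<And>k x. x \<in> topspace X \<Longrightarrow> \<exists>p. limitin X p x sequentially \<and> (\<forall>n::nat. f k (p n) \<noteq> 0)"
    and cover: "\<And>x. x \<in> topspace X - S \<Longrightarrow> \<exists>k. f k x = 0"
  shows "comeager_in X S"
proof -
  define N where "N k = {x \<in> topspace X. f k x = 0}" for k
  have closed: "closedin X (N k)" for k
    using closedin_continuous_map_preimage[OF cont, of "{0}" k] by (simp add: N_def)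
  have "X interior_of (N k) = {}" for k
  proof (rule ccontr)
    assume "X interior_of (N k) \<noteq> {}"
    then obtain x where x: "x \<in> X interior_of (N k)"
      by blast
    then have "x \<in> topspace X"
      using interior_of_subset_topspace by fastforce
    then obtain p where "limitin X p x sequentially" and ne: "\<And>n. f k (p n) \<noteq> 0"
      using dense by blast
    then have "\<forall>\<^sub>F n in sequentially. p n \<in> X interior_of (N k)"
      using x openin_interior_of by (fastforce simp: limitin_def)
    then obtain n where "p n \<in> X interior_of (N k)"
      by (auto simp: eventually_sequentially)
    then have "p n \<in> N k"
      using interior_of_subset by fastforce
    with ne show False
      by (simp add: N_def)
  qed
  then have "\<forall>M\<in>range N. nowhere_dense_in X M"
    using closed by (auto simp: nowhere_dense_in_def closure_of_closedin N_def)
  moreover have "topspace X - S \<subseteq> \<Union>(range N)"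
    using cover by (auto simp: N_def)
  ultimately show ?thesis
    using assms(1) unfolding comeager_in_def meager_in_def
    by (intro conjI exI[of _ "range N"]) auto
qed

section \<open>The weak topology\<close>

text \<open>Convergence may be tested on a subbase: eventual membership is inherited by finite
  intersections and by arbitrary unions, the two ways in which open sets are built from
  \<open>B\<close>.\<close>

lemma limitin_topology_generated_by:
  assumes "x \<in> \<Union>B" and ev: "\<And>U. U \<in> B \<Longrightarrow> x \<in> U \<Longrightarrow> eventually (\<lambda>n. p n \<in> U) F"
  shows "limitin (topology_generated_by B) p x F"
proof -
  have "x \<in> U \<longrightarrow> eventually (\<lambda>n. p n \<in> U) F" if "generate_topology_on B U" for U
    using that
  proof (induction rule: generate_topology_on.induct)
    case (UN K)
    then show ?case
      by (blast intro: eventually_mono)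
  qed (auto simp: ev eventually_conj_iff)
  then show ?thesis
    using assms(1) by (auto simp: limitin_def openin_topology_generated_by_iff)
qed

lemma continuous_map_integral_weak_topology:
  fixes f :: "'a::topological_space \<Rightarrow> real"
  assumes "continuous_on S f" "bounded (f ` S)"
  shows "continuous_map (weak_topology S) euclideanreal (\<lambda>M. LINT x|M. f x)"
proof -
  have "openin (weak_topology S) {M \<in> borel_probs S. (LINT x|M. f x) \<in> U}" if "open U" for U
    unfolding weak_topology_def using assms that by (intro topology_generated_by_Basis) blast
  then show ?thesis
    by (simp add: continuous_map topspace_weak_topology)
qed

lemma limitin_weak_topology:
  assumes "M \<in> borel_probs S" "\<And>n. P n \<in> borel_probs S"
    and lim: "\<And>f :: 'a::topological_space \<Rightarrow> real. continuous_on S f \<Longrightarrow> bounded (f ` S)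
      \<Longrightarrow> ((\<lambda>n. LINT x|P n. f x) \<longlongrightarrow> (LINT x|M. f x)) F"
  shows "limitin (weak_topology S) P M F"
  unfolding weak_topology_def
proof (rule limitin_topology_generated_by)
  show "M \<in> \<Union>{{M \<in> borel_probs S. (LINT x|M. f x) \<in> U} | (f :: 'a \<Rightarrow> real) U.
      continuous_on S f \<and> bounded (f ` S) \<and> open U}"
    using assms(1) topspace_weak_topology[of S] by (simp add: weak_topology_def)
next
  fix V
  assume "V \<in> {{M \<in> borel_probs S. (LINT x|M. f x) \<in> U} | (f :: 'a \<Rightarrow> real) U.
      continuous_on S f \<and> bounded (f ` S) \<and> open U}" and "M \<in> V"
  then obtain f :: "'a \<Rightarrow> real" and U where V: "V = {M \<in> borel_probs S. (LINT x|M. f x) \<in> U}"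
    and f: "continuous_on S f" "bounded (f ` S)" and U: "open U" "(LINT x|M. f x) \<in> U"
    by auto
  show "eventually (\<lambda>n. P n \<in> V) F"
    using topological_tendstoD[OF lim[OF f] U] by eventually_elim (simp add: V assms(2))
qed

section \<open>Mixtures of probability measures\<close>

text \<open>This is the convex combination \<open>s * M + (1 - s) * N\<close>, encoded as a coin
  toss followed by a draw from the chosen measure, so that the facts about \<open>bind\<close>
  supply its integrals and its total mass.\<close>

definition mixture :: "real \<Rightarrow> 'a measure \<Rightarrow> 'a measure \<Rightarrow> 'a measure" where
  "mixture s M N = measure_pmf (bernoulli_pmf s) \<bind> (\<lambda>b. if b then M else N)"

context
  fixes M N K :: "'a measure" and s :: real
  assumes prob: "prob_space M" "prob_space N"
    and sets: "sets M = sets K" "sets N = sets K"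
    and s: "0 \<le> s" "s \<le> 1"
begin

private lemma kernel:
  "(\<lambda>b. if b then M else N) \<in> measurable (measure_pmf (bernoulli_pmf s)) (subprob_algebra K)"
  using prob sets by (auto simp: space_subprob_algebra prob_space_imp_subprob_space split: if_splits)

lemma prob_space_mixture: "prob_space (mixture s M N)"
  unfolding mixture_def
  by (rule measure_pmf.prob_space_bind[OF _ kernel]) (use prob in auto)

lemma sets_mixture: "sets (mixture s M N) = sets K"
  unfolding mixture_def by (rule sets_bind) (auto simp: sets)

lemma integral_mixture:
  fixes f :: "'a \<Rightarrow> real"
  assumes "f \<in> borel_measurable K" "\<And>x. x \<in> space K \<Longrightarrow> \<bar>f x\<bar> \<le> B"
  shows "(LINT x|mixture s M N. f x) = s * (LINT x|M. f x) + (1 - s) * (LINT x|N. f x)"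
  unfolding mixture_def
  by (subst integral_bind[OF assms kernel, where B' = 1])
    (use prob s in \<open>auto simp: prob_space.emeasure_space_1 measure_pmf.finite_measure_axioms\<close>)

lemma measure_mixture:
  assumes "A \<in> sets K"
  shows "measure (mixture s M N) A = s * measure M A + (1 - s) * measure N A"
  unfolding mixture_def
  by (subst measure_pmf.measure_bind[OF kernel assms]) (use s in auto)

end

text \<open>\<open>P_W d\<close> is convex, because its two constraints prescribe the values of
  quantities that are affine in the measure.\<close>

lemma mixture_in_P_W:
  assumes "\<nu> \<in> P_W d" "\<gamma> \<in> P_W d" "0 \<le> s" "s \<le> 1"
  shows "mixture s \<nu> \<gamma> \<in> P_W d"
proof -
  let ?K = "restrict_space borel {0..} :: real measure"
  note prems = assms(1,2)[unfolded P_W_def borel_probs_def, simplified]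
  have pr: "prob_space \<nu>" "prob_space \<gamma>" and se: "sets \<nu> = sets ?K" "sets \<gamma> = sets ?K"
    using prems by auto
  note mix = pr se assms(3,4)
  have int: "(LINT t:{0..1}|mixture s \<nu> \<gamma>. (1 - t) ^ (d - 1)) = 1 / 2"
  proof -
    have "(\<lambda>t::real. indicat_real {0..1} t *\<^sub>R (1 - t) ^ (d - 1)) \<in> borel_measurable ?K"
      by (intro measurable_restrict_space1) measurable
    moreover have "\<bar>indicat_real {0..1} t *\<^sub>R (1 - t) ^ (d - 1)\<bar> \<le> 1" for t :: real
      by (auto simp: indicator_def power_le_one)
    ultimately have "(LINT t:{0..1}|mixture s \<nu> \<gamma>. (1 - t) ^ (d - 1))
        = s * (LINT t:{0..1}|\<nu>. (1 - t) ^ (d - 1)) + (1 - s) * (LINT t:{0..1}|\<gamma>. (1 - t) ^ (d - 1))"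
      unfolding set_lebesgue_integral_def by (intro integral_mixture[OF mix]) auto
    moreover have "(LINT t:{0..1}|M. (1 - t) ^ (d - 1)) = 1 / 2" if "M \<in> P_W d" for M
      using that by (simp add: P_W_def)
    ultimately show ?thesis
      using assms(1,2) by (simp only:) (simp add: field_simps)
  qed
  have "{0} \<in> sets ?K"
    by (simp add: sets_restrict_space_iff)
  then have "measure (mixture s \<nu> \<gamma>) {0} = 0"
    using prems by (subst measure_mixture[OF mix]) auto
  then show ?thesis
    using prob_space_mixture[OF mix] sets_mixture[OF mix] int by (simp add: P_W_def borel_probs_def)
qed

text \<open>Integrals against the mixture are convex combinations of two fixed numbers, and the
  weight of \<open>\<nu>\<close> tends to 0.\<close>

lemma limitin_mixture:
  assumes "\<nu> \<in> P_W d" "\<gamma> \<in> P_W d"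
  shows "limitin (subtopology (weak_topology {0..}) (P_W d))
    (\<lambda>n. mixture (1 / real (Suc n)) \<nu> \<gamma>) \<gamma> sequentially"
proof -
  have P: "mixture (1 / real (Suc n)) \<nu> \<gamma> \<in> P_W d" for n
    by (rule mixture_in_P_W[OF assms]) auto
  have sub: "P_W d \<subseteq> borel_probs {0..}"
    by (auto simp: P_W_def)
  have "limitin (weak_topology {0..}) (\<lambda>n. mixture (1 / real (Suc n)) \<nu> \<gamma>) \<gamma> sequentially"
  proof (rule limitin_weak_topology)
    fix f :: "real \<Rightarrow> real"
    assume f: "continuous_on {0..} f" "bounded (f ` {0..})"
    then obtain B where B: "\<And>x. x \<ge> 0 \<Longrightarrow> \<bar>f x\<bar> \<le> B"
      by (auto simp: bounded_iff)
    have "(LINT x|mixture (1 / real (Suc n)) \<nu> \<gamma>. f x)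
        = 1 / real (Suc n) * (LINT x|\<nu>. f x) + (1 - 1 / real (Suc n)) * (LINT x|\<gamma>. f x)" for n
      by (rule integral_mixture[where K = "restrict_space borel {0..}" and B = B])
        (use assms sub B f in \<open>auto simp: P_W_def borel_probs_def space_restrict_space
          intro: borel_measurable_continuous_on_restrict\<close>)
    moreover have "(\<lambda>n. 1 / real (Suc n) * (LINT x|\<nu>. f x) + (1 - 1 / real (Suc n)) * (LINT x|\<gamma>. f x))
        \<longlonglongrightarrow> 0 * (LINT x|\<nu>. f x) + (1 - 0) * (LINT x|\<gamma>. f x)"
      by (intro tendsto_intros LIMSEQ_Suc lim_1_over_n)
    ultimately show "(\<lambda>n. LINT x|mixture (1 / real (Suc n)) \<nu> \<gamma>. f x) \<longlonglongrightarrow> (LINT x|\<gamma>. f x)"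
      by simp
  qed (use assms P sub in auto)
  then show ?thesis
    using P assms by (simp add: limitin_subtopology)
qed

text \<open>One atom in \<open>(0, r)\<close> carries the whole integral constraint; the remaining
  mass goes where both integrands vanish. The result is the direction in which a given measure is
  perturbed.\<close>

lemma P_W_two_point:
  assumes "d \<ge> 2" "r > 0"
  obtains \<nu> where "\<nu> \<in> P_W d" "(LINT t|\<nu>. max 0 (r - t)) > 0"
proof -
  let ?K = "restrict_space borel {0..} :: real measure"
  \<comment> \<open>The bound \<open>r / 2\<close> puts the atom below \<open>r\<close>. The bound
    \<open>1 / (2 * real d)\<close> gives \<open>(1 - t0) ^ (d - 1) \<ge> 1 / 2\<close> by
    Bernoulli's inequality, so that the weight \<open>a\<close> is at most 1.\<close>
  define t0 where "t0 = min (r / 2) (1 / (2 * real d))"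
  have t0: "0 < t0" "t0 < r" "t0 < 1" "real d * t0 \<le> 1 / 2"
  proof -
    show "0 < t0" "t0 < r"
      using assms by (auto simp: t0_def min_less_iff_disj)
    have "t0 \<le> 1 / (2 * real d)"
      by (simp add: t0_def)
    then show "real d * t0 \<le> 1 / 2"
      using assms by (simp add: field_simps)
    have "1 / (2 * real d) < 1"
      using assms by (simp add: field_simps)
    with \<open>t0 \<le> _\<close> show "t0 < 1"
      by linarith
  qed
  have "1 / 2 \<le> 1 + real (d - 1) * (- t0)"
    using t0 assms by (auto simp: of_nat_diff algebra_simps)
  also have "\<dots> \<le> (1 - t0) ^ (d - 1)"
    using Bernoulli_inequality[of "- t0" "d - 1"] t0 by simp
  finally have half: "1 / 2 \<le> (1 - t0) ^ (d - 1)" .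
  define a where "a = 1 / 2 / (1 - t0) ^ (d - 1)"
  have a: "0 < a" "a \<le> 1" "a * (1 - t0) ^ (d - 1) = 1 / 2"
    using half t0 by (auto simp: a_def field_simps)
  \<comment> \<open>The second atom is at least 1, so it adds nothing to the constraint (at 1 itself
    because \<open>d - 1 > 0\<close>), and at least \<open>r\<close>, so it adds nothing to the
    integral of \<open>max 0 (r - t)\<close>.\<close>
  define p where "p = (\<lambda>b. if b then t0 else max 1 r)"
  define \<nu> where "\<nu> = distr (measure_pmf (bernoulli_pmf a)) ?K p"
  have p: "p \<in> measurable (measure_pmf (bernoulli_pmf a)) ?K"
    using t0 by (auto simp: p_def space_restrict_space)
  have int: "(LINT t|\<nu>. f t) = a * f t0 + (1 - a) * f (max 1 r)"
    if "f \<in> borel_measurable borel" for f :: "real \<Rightarrow> real"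
    unfolding \<nu>_def
    by (subst integral_distr[OF p measurable_restrict_space1[OF that]]) (use a in \<open>auto simp: p_def\<close>)
  have "p -` {0} = {}"
    using t0 by (auto simp: p_def split: if_splits)
  then have "measure \<nu> {0} = 0"
    unfolding \<nu>_def by (subst measure_distr[OF p]) (auto simp: sets_restrict_space_iff)
  moreover have "(LINT t:{0..1}|\<nu>. (1 - t) ^ (d - 1)) = 1 / 2"
    unfolding set_lebesgue_integral_def
    using t0 a assms by (subst int) (auto simp: indicator_def max_def)
  moreover have "prob_space \<nu>"
    unfolding \<nu>_def by (rule measure_pmf.prob_space_distr[OF p])
  ultimately have "\<nu> \<in> P_W d"
    by (simp add: P_W_def borel_probs_def) (simp add: \<nu>_def)
  moreover have "(LINT t|\<nu>. max 0 (r - t)) > 0"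
    using t0 a by (subst int) auto
  ultimately show ?thesis ..
qed

section \<open>Measures with mass arbitrarily close to 0\<close>

theorem comeager_P_W_s:
  assumes "d \<ge> 2"
  shows "comeager_in (subtopology (weak_topology {0..}) (P_W d)) (P_W_s d)"
proof -
  have sub: "P_W d \<subseteq> borel_probs {0..}"
    by (auto simp: P_W_def)
  have top: "topspace (subtopology (weak_topology {0..}) (P_W d)) = P_W d"
    using sub by (auto simp: topspace_weak_topology)
  define r :: "nat \<Rightarrow> real" where "r k = 1 / real (Suc k)" for k
  \<comment> \<open>On \<open>{0..}\<close> the function \<open>g k\<close> is bounded, continuous
    and positive exactly on \<open>[0, r k)\<close>. Its integral is a weakly continuous substitute
    for the mass of \<open>(0, r k)\<close>, which need not depend continuously on the
    measure.\<close>
  define g :: "nat \<Rightarrow> real \<Rightarrow> real" where "g k t = max 0 (r k - t)" for k t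
  have r: "r k > 0" for k
    by (simp add: r_def)
  have g: "0 \<le> g k t" "t \<ge> 0 \<Longrightarrow> \<bar>g k t\<bar> \<le> r k" for k t
    using r[of k] by (auto simp: g_def)
  have cont: "continuous_on A (g k)" for k A
    unfolding g_def by (intro continuous_intros)
  have meas: "g k \<in> borel_measurable (restrict_space borel {0..})" for k
    by (rule borel_measurable_continuous_on_restrict[OF cont])
  show ?thesis
  proof (rule comeager_inI[where f = "\<lambda>k M. LINT t|M. g k t"])
    show "P_W_s d \<subseteq> topspace (subtopology (weak_topology {0..}) (P_W d))"
      unfolding top by (auto simp: P_W_s_def)
    show "continuous_map (subtopology (weak_topology {0..}) (P_W d)) euclideanreal
        (\<lambda>M. LINT t|M. g k t)" for k
    proof (intro continuous_map_from_subtopology continuous_map_integral_weak_topology cont)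
      show "bounded (g k ` {0..})"
        unfolding bounded_iff using g(2)[of _ k] by (auto intro!: exI[of _ "r k"])
    qed
  next
    fix k \<gamma> assume "\<gamma> \<in> topspace (subtopology (weak_topology {0..}) (P_W d))"
    then have \<gamma>: "\<gamma> \<in> P_W d"
      by (simp add: top)
    obtain \<nu> where \<nu>: "\<nu> \<in> P_W d" "(LINT t|\<nu>. g k t) > 0"
      using P_W_two_point[OF assms r, of k] unfolding g_def by blast
    have "(LINT t|mixture (1 / real (Suc n)) \<nu> \<gamma>. g k t) > 0" for n
    proof -
      have "(LINT t|mixture (1 / real (Suc n)) \<nu> \<gamma>. g k t)
          = 1 / real (Suc n) * (LINT t|\<nu>. g k t) + (1 - 1 / real (Suc n)) * (LINT t|\<gamma>. g k t)"
        by (rule integral_mixture[OF _ _ _ _ _ _ meas, where B = "r k"])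
          (use \<gamma> \<nu> g(2) in \<open>auto simp: P_W_def borel_probs_def space_restrict_space\<close>)
      moreover have "0 \<le> (LINT t|\<gamma>. g k t)"
        by (simp add: g)
      ultimately show ?thesis
        using \<nu>(2) by (simp add: add_pos_nonneg)
    qed
    then show "\<exists>p. limitin (subtopology (weak_topology {0..}) (P_W d)) p \<gamma> sequentially
        \<and> (\<forall>n. (LINT t|p n. g k t) \<noteq> 0)"
      using limitin_mixture[OF \<nu>(1) \<gamma>] by (metis less_irrefl)
  next
    fix \<gamma> assume "\<gamma> \<in> topspace (subtopology (weak_topology {0..}) (P_W d)) - P_W_s d"
    then have \<gamma>: "\<gamma> \<in> P_W d" "\<gamma> \<notin> P_W_s d"
      by (auto simp: top)
    then obtain \<rho> where \<rho>: "\<rho> > 0" "measure \<gamma> {0<..<\<rho>} = 0"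
      by (auto simp: P_W_s_def not_less measure_le_0_iff)
    obtain k where k: "r k < \<rho>"
      using reals_Archimedean[OF \<rho>(1)] by (auto simp: r_def inverse_eq_divide)
    have sets: "sets \<gamma> = sets (restrict_space borel {0..})" and 0: "measure \<gamma> {0} = 0"
      and "prob_space \<gamma>"
      using \<gamma>(1) by (auto simp: P_W_def borel_probs_def)
    interpret prob_space \<gamma> by fact
    have space: "space \<gamma> = {0..}"
      using sets_eq_imp_space_eq[OF sets] by (simp add: space_restrict_space)
    \<comment> \<open>With no mass on \<open>[0, \<rho>)\<close> and \<open>r k < \<rho>\<close>,
      the function \<open>g k\<close> vanishes almost everywhere.\<close>
    have "{0} \<in> null_sets \<gamma>" "{0<..<\<rho>} \<in> null_sets \<gamma>"
      using 0 \<rho> by (auto simp: null_sets_def sets sets_restrict_space_iff emeasure_eq_measure)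
    from this[THEN AE_not_in] have "AE t in \<gamma>. g k t = 0"
      using AE_space by eventually_elim (use k in \<open>auto simp: g_def space\<close>)
    then show "\<exists>k. (LINT t|\<gamma>. g k t) = 0"
      using integral_eq_zero_AE by blast
  qed
qed

section \<open>Generators and their pseudo-inverses\<close>

context
  fixes \<psi> :: "real \<Rightarrow> real"
  assumes gen: "generator \<psi>"
begin

lemma generator_range: "z \<ge> 0 \<Longrightarrow> 0 \<le> \<psi> z \<and> \<psi> z \<le> 1"
  using gen by (auto simp: generator_def)

lemma generator_antimono: "0 \<le> x \<Longrightarrow> x \<le> y \<Longrightarrow> \<psi> y \<le> \<psi> x"
  using gen by (auto simp: generator_def monotone_on_def)

text \<open>The zero set is closed by continuity, so its infimum is attained; it is positive because
  \<open>\<psi> 0 = 1\<close>.\<close>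

lemma generator_least_zero:
  assumes "x \<ge> 0" "\<psi> x = 0"
  obtains z0 where "z0 > 0" "\<psi> z0 = 0" "\<And>z. z \<ge> 0 \<Longrightarrow> \<psi> z = 0 \<Longrightarrow> z0 \<le> z"
proof -
  define Z where "Z = {z\<in>{0..}. \<psi> z = 0}"
  have bdd: "bdd_below Z"
    by (auto simp: Z_def bdd_below_def)
  have "closed Z"
    unfolding Z_def using gen
    by (intro continuous_closed_preimage_constant) (auto simp: generator_def)
  then have "Inf Z \<in> Z"
    using bdd assms by (intro closed_contains_Inf) (auto simp: Z_def)
  moreover have "Inf Z \<noteq> 0"
    using calculation gen by (auto simp: Z_def generator_def)
  ultimately show ?thesis
    using that[of "Inf Z"] cInf_lower[OF _ bdd] by (force simp: Z_def)
qed

text \<open>This frees the strictness clause of \<open>generator\<close> from the infimum in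
  \<open>ennreal\<close>: a point with a positive value lies before the first zero, and if
  \<open>\<psi> y = 0\<close> the claim is immediate.\<close>

lemma generator_strict_antimono:
  assumes "0 \<le> x" "x < y" "\<psi> x > 0"
  shows "\<psi> y < \<psi> x"
proof (cases "\<psi> y = 0")
  case False
  then have y: "\<psi> y > 0"
    using generator_range[of y] assms by auto
  let ?I = "INF x\<in>{x. 0 \<le> x \<and> \<psi> x = 0}. ennreal x"
  have "ennreal y < ?I"
  proof (cases "\<exists>z\<ge>0. \<psi> z = 0")
    case True
    then obtain z0 where z0: "z0 > 0" "\<psi> z0 = 0" "\<And>z. z \<ge> 0 \<Longrightarrow> \<psi> z = 0 \<Longrightarrow> z0 \<le> z"
      by (metis generator_least_zero)
    have "y < z0"
      using generator_antimono[of z0 y] z0 y by force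
    then have "ennreal y < ennreal z0"
      using z0(1) by (simp add: ennreal_lessI)
    also have "\<dots> \<le> ?I"
      using z0(3) by (auto intro!: INF_greatest ennreal_leI)
    finally show ?thesis .
  next
    case False
    then have "{x. 0 \<le> x \<and> \<psi> x = 0} = {}"
      by blast
    then show ?thesis
      by (simp only:) simp
  qed
  moreover have "ennreal x \<le> ennreal y"
    using assms by (simp add: ennreal_leI)
  ultimately have "ennreal x < ?I" "ennreal y < ?I"
    by (auto intro: le_less_trans)
  then show ?thesis
    using gen assms unfolding generator_def monotone_on_def by auto
qed (use assms in simp)

lemma gen_ext_0 [simp]: "gen_ext \<psi> 0 = 1"
  using gen by (simp add: gen_ext_def generator_def)

lemma gen_ext_range: "0 \<le> gen_ext \<psi> z" "gen_ext \<psi> z \<le> 1"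
  using generator_range by (auto simp: gen_ext_def)

lemma gen_ext_antimono:
  assumes "z \<le> w"
  shows "gen_ext \<psi> w \<le> gen_ext \<psi> z"
proof (cases "w = \<infinity>")
  case False
  then have "w < top"
    by (simp add: less_top)
  then have "\<psi> (enn2real w) \<le> \<psi> (enn2real z)"
    using assms by (intro generator_antimono enn2real_mono) auto
  moreover have "z \<noteq> \<infinity>"
    using assms \<open>w < top\<close> by (auto simp: top_unique)
  ultimately show ?thesis
    using False by (simp add: gen_ext_def)
qed (use gen_ext_range in \<open>simp add: gen_ext_def\<close>)

lemma gen_ext_strict_antimono:
  assumes "z < w" "gen_ext \<psi> z > 0"
  shows "gen_ext \<psi> w < gen_ext \<psi> z"
proof (cases "w = \<infinity>")
  case False
  then obtain x y where "z = ennreal x" "w = ennreal y" "x \<ge> 0" "y \<ge> 0"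
    using assms by (metis enn2real_nonneg ennreal_enn2real infinity_ennreal_def less_top order.strict_trans)
  then show ?thesis
    using assms by (auto simp: gen_ext_def ennreal_less_iff intro!: generator_strict_antimono)
qed (use assms in \<open>simp add: gen_ext_def\<close>)

text \<open>A positive value is attained only once, by strict monotonicity, so the infimum is taken
  over a singleton.\<close>

lemma pseudo_inverse_gen_ext:
  assumes "gen_ext \<psi> z > 0"
  shows "pseudo_inverse \<psi> (gen_ext \<psi> z) = z"
proof -
  have "w = z" if "gen_ext \<psi> w = gen_ext \<psi> z" for w
    using gen_ext_strict_antimono[of w z] gen_ext_strict_antimono[of z w] assms that
    by (cases w z rule: linorder_cases) auto
  then have "{w. gen_ext \<psi> w = gen_ext \<psi> z} = {z}"
    by auto
  then show ?thesis
    by (simp add: pseudo_inverse_def)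
qed

lemma gen_ext_surj:
  assumes "0 < y" "y \<le> 1"
  obtains z where "gen_ext \<psi> z = y"
proof -
  have "eventually (\<lambda>z. \<psi> z < y) at_top"
    using gen assms by (auto simp: generator_def intro: order_tendstoD)
  then obtain b where b: "b \<ge> 0" "\<psi> b < y"
    using eventually_ge_at_top[of 0] eventually_happens'[OF _ eventually_conj]
    by (metis (no_types, lifting) trivial_limit_at_top_linorder)
  have "\<exists>z. 0 \<le> z \<and> z \<le> b \<and> \<psi> z = y"
    using b assms gen
    by (intro IVT2') (auto simp: generator_def intro: continuous_on_subset)
  then obtain z where "z \<ge> 0" "\<psi> z = y"
    by blast
  then have "gen_ext \<psi> (ennreal z) = y"
    by (simp add: gen_ext_def)
  then show ?thesis ..
qed

text \<open>The infimum is attained at the least zero or, if there is none, at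
  \<open>\<infinity>\<close>, where the extension takes the value 0.\<close>

lemma gen_ext_pseudo_inverse_0: "gen_ext \<psi> (pseudo_inverse \<psi> 0) = 0"
proof (cases "\<exists>z\<ge>0. \<psi> z = 0")
  case True
  then obtain z0 where z0: "z0 > 0" "\<psi> z0 = 0" "\<And>z. z \<ge> 0 \<Longrightarrow> \<psi> z = 0 \<Longrightarrow> z0 \<le> z"
    by (metis generator_least_zero)
  have "pseudo_inverse \<psi> 0 = ennreal z0"
    unfolding pseudo_inverse_def
  proof (rule antisym)
    show "Inf {z. gen_ext \<psi> z = 0} \<le> ennreal z0"
      using z0 by (intro Inf_lower) (simp add: gen_ext_def)
    show "ennreal z0 \<le> Inf {z. gen_ext \<psi> z = 0}"
    proof (rule Inf_greatest)
      fix z assume "z \<in> {z. gen_ext \<psi> z = 0}"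
      then show "ennreal z0 \<le> z"
        using z0(3)[of "enn2real z"]
        by (cases z) (auto simp: gen_ext_def ennreal_leI split: if_splits)
    qed
  qed
  then show ?thesis
    using z0 by (simp add: gen_ext_def)
next
  case False
  then have "{z. gen_ext \<psi> z = 0} = {\<infinity>}"
    by (auto simp: gen_ext_def)
  then show ?thesis
    by (simp add: pseudo_inverse_def gen_ext_def)
qed

lemma gen_ext_pseudo_inverse:
  assumes "y \<in> {0..1}"
  shows "gen_ext \<psi> (pseudo_inverse \<psi> y) = y"
proof (cases "y = 0")
  case False
  then obtain z where "gen_ext \<psi> z = y"
    using gen_ext_surj[of y] assms by auto
  then show ?thesis
    using pseudo_inverse_gen_ext[of z] False assms by auto
qed (simp add: gen_ext_pseudo_inverse_0)

lemma pseudo_inverse_1 [simp]: "pseudo_inverse \<psi> 1 = 0"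
  using pseudo_inverse_gen_ext[of 0] by simp

lemma pseudo_inverse_antimono:
  assumes "x \<in> {0..1}" "y \<in> {0..1}" "x \<le> y"
  shows "pseudo_inverse \<psi> y \<le> pseudo_inverse \<psi> x"
proof (cases "x = y")
  case False
  show ?thesis
  proof (rule ccontr)
    assume "\<not> ?thesis"
    then have "y \<le> x"
      using gen_ext_antimono[of "pseudo_inverse \<psi> x" "pseudo_inverse \<psi> y"]
        gen_ext_pseudo_inverse[of x] gen_ext_pseudo_inverse[of y] assms by simp
    with False assms show False
      by simp
  qed
qed simp

lemma gen_ext_eq_0_if_ge: "pseudo_inverse \<psi> 0 \<le> z \<Longrightarrow> gen_ext \<psi> z = 0"
  using gen_ext_antimono[of "pseudo_inverse \<psi> 0" z] gen_ext_range(1)[of z]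
  by (simp add: gen_ext_pseudo_inverse_0)

text \<open>If some \<open>z i\<close> lies beyond the first zero of \<open>\<psi>\<close>, then \<open>pseudo_inverse\<close> moves it back to
  that zero, but both sides are \<open>0\<close>.\<close>

lemma gen_ext_sum_pseudo_inverse:
  assumes "finite A"
  shows "gen_ext \<psi> (\<Sum>i\<in>A. pseudo_inverse \<psi> (gen_ext \<psi> (z i))) = gen_ext \<psi> (\<Sum>i\<in>A. z i)"
proof (cases "\<exists>i\<in>A. gen_ext \<psi> (z i) = 0")
  case True
  then obtain i where i: "i \<in> A" "gen_ext \<psi> (z i) = 0"
    by blast
  have "pseudo_inverse \<psi> 0 \<le> z i"
    unfolding pseudo_inverse_def using i by (intro Inf_lower) simp
  also have "\<dots> \<le> (\<Sum>i\<in>A. z i)"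
    using i assms by (intro member_le_sum) auto
  finally have "gen_ext \<psi> (\<Sum>i\<in>A. z i) = 0"
    by (rule gen_ext_eq_0_if_ge)
  moreover have "pseudo_inverse \<psi> (gen_ext \<psi> (z i)) \<le> (\<Sum>i\<in>A. pseudo_inverse \<psi> (gen_ext \<psi> (z i)))"
    using i(1) assms by (intro member_le_sum) auto
  then have "gen_ext \<psi> (\<Sum>i\<in>A. pseudo_inverse \<psi> (gen_ext \<psi> (z i))) = 0"
    using i(2) by (intro gen_ext_eq_0_if_ge) simp
  ultimately show ?thesis
    by simp
next
  case False
  then have "gen_ext \<psi> (z i) > 0" if "i \<in> A" for i
    using gen_ext_range(1)[of "z i"] that by force
  then show ?thesis
    by (simp add: pseudo_inverse_gen_ext)
qed

end

section \<open>Archimedean copulas\<close>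

text \<open>This replaces the condition on derivatives that characterizes Archimedean copulas. It is
  affine in \<open>\<psi>\<close>, and infinite \<open>v i\<close> reduce the order of the difference.\<close>

definition difference_monotone :: "nat \<Rightarrow> (real \<Rightarrow> real) \<Rightarrow> bool" where
  "difference_monotone d \<psi> \<longleftrightarrow> (\<forall>u v. (\<forall>i<d. u i \<le> v i) \<longrightarrow>
     0 \<le> (\<Sum>S\<in>Pow {..<d}. (- 1) ^ card S * gen_ext \<psi> (\<Sum>i<d. if i \<in> S then v i else u i)))"

lemma box_volume_arch_fun:
  assumes "a \<in> unit_cube d" "b \<in> unit_cube d"
  shows "box_volume d (arch_fun d \<psi>) a b =
    (\<Sum>S\<in>Pow {..<d}. (- 1) ^ card S *
      gen_ext \<psi> (\<Sum>i<d. pseudo_inverse \<psi> (if i \<in> S then a i else b i)))"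
  unfolding box_volume_def
proof (intro sum.cong refl)
  fix S
  have "(\<lambda>i\<in>{..<d}. if i \<in> S then a i else b i) \<in> unit_cube d"
    using assms by (auto simp: unit_cube_def PiE_iff)
  then show "(- 1) ^ card S * arch_fun d \<psi> (\<lambda>i\<in>{..<d}. if i \<in> S then a i else b i) =
      (- 1) ^ card S * gen_ext \<psi> (\<Sum>i<d. pseudo_inverse \<psi> (if i \<in> S then a i else b i))"
    by (simp add: arch_fun_def)
qed

text \<open>Groundedness and uniform margins hold for every generator, so only box volumes matter.
  Passing from corners to their pseudo-inverses turns box volumes into the alternating differences
  of \<open>difference_monotone\<close>.\<close>

lemma copula_arch_fun_iff:
  assumes gen: "generator \<psi>"
  shows "copula d (arch_fun d \<psi>) \<longleftrightarrow> difference_monotone d \<psi>"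
proof
  assume C: "copula d (arch_fun d \<psi>)"
  show "difference_monotone d \<psi>"
    unfolding difference_monotone_def
  proof (intro allI impI)
    fix u v :: "nat \<Rightarrow> ennreal"
    assume uv: "\<forall>i<d. u i \<le> v i"
    \<comment> \<open>The larger arguments \<open>v\<close> give the lower corner, since
      \<open>gen_ext \<psi>\<close> is decreasing.\<close>
    define a where "a = (\<lambda>i\<in>{..<d}. gen_ext \<psi> (v i))"
    define b where "b = (\<lambda>i\<in>{..<d}. gen_ext \<psi> (u i))"
    have ab: "a \<in> unit_cube d" "b \<in> unit_cube d" "\<forall>i<d. a i \<le> b i"
      using gen_ext_range[OF gen] gen_ext_antimono[OF gen] uv
      by (auto simp: a_def b_def unit_cube_def)
    have "(\<Sum>i<d. pseudo_inverse \<psi> (if i \<in> S then a i else b i))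
        = (\<Sum>i<d. pseudo_inverse \<psi> (gen_ext \<psi> (if i \<in> S then v i else u i)))" for S
      by (intro sum.cong refl) (simp add: a_def b_def)
    then have "box_volume d (arch_fun d \<psi>) a b =
        (\<Sum>S\<in>Pow {..<d}. (- 1) ^ card S * gen_ext \<psi> (\<Sum>i<d. if i \<in> S then v i else u i))"
      using ab by (simp add: box_volume_arch_fun gen_ext_sum_pseudo_inverse[OF gen])
    moreover have "0 \<le> box_volume d (arch_fun d \<psi>) a b"
      using C ab by (simp add: copula_def)
    ultimately show "0 \<le> (\<Sum>S\<in>Pow {..<d}. (- 1) ^ card S *
        gen_ext \<psi> (\<Sum>i<d. if i \<in> S then v i else u i))"
      by simp
  qed
next
  assume D: "difference_monotone d \<psi>"
  show "copula d (arch_fun d \<psi>)"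
    unfolding copula_def
  proof (intro conjI ballI allI impI)
    show "arch_fun d \<psi> \<in> unit_cube d \<rightarrow>\<^sub>E {0..1}"
      using gen_ext_range[OF gen] by (auto simp: arch_fun_def)
  next
    fix x assume x: "x \<in> unit_cube d" "\<exists>i<d. x i = 0"
    then obtain i where i: "i < d" "x i = 0"
      by blast
    have "pseudo_inverse \<psi> (x i) \<le> (\<Sum>i<d. pseudo_inverse \<psi> (x i))"
      using i by (intro member_le_sum) auto
    then show "arch_fun d \<psi> x = 0"
      using x i gen_ext_eq_0_if_ge[OF gen] by (simp add: arch_fun_def)
  next
    fix i and u :: real
    assume i: "i < d" and u: "u \<in> {0..1}"
    have "(\<lambda>j\<in>{..<d}. if j = i then u else 1) \<in> unit_cube d"
      using u by (auto simp: unit_cube_def)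
    moreover have "(\<Sum>j<d. pseudo_inverse \<psi> (if j = i then u else 1))
        = (\<Sum>j<d. if j = i then pseudo_inverse \<psi> u else 0)"
      using gen by (intro sum.cong) auto
    ultimately show "arch_fun d \<psi> (\<lambda>j\<in>{..<d}. if j = i then u else 1) = u"
      using i u gen_ext_pseudo_inverse[OF gen u] by (simp add: arch_fun_def)
  next
    fix a b assume ab: "a \<in> unit_cube d" "b \<in> unit_cube d" "\<forall>i<d. a i \<le> b i"
    have "\<forall>i<d. pseudo_inverse \<psi> (b i) \<le> pseudo_inverse \<psi> (a i)"
      using ab pseudo_inverse_antimono[OF gen] by (auto simp: unit_cube_def PiE_iff)
    then show "0 \<le> box_volume d (arch_fun d \<psi>) a b"
      using D ab by (simp add: box_volume_arch_fun difference_monotone_def if_distrib)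
  qed
qed

text \<open>A form of convexity: the drop from \<open>a\<close> to \<open>b\<close> does not grow
  when both are shifted by \<open>c\<close>. It is the alternating difference in two coordinates
  only.\<close>

lemma difference_monotone_second_difference:
  assumes D: "difference_monotone d \<psi>" and "d \<ge> 2" "a \<le> b"
  shows "gen_ext \<psi> (a + c) - gen_ext \<psi> (b + c) \<le> gen_ext \<psi> a - gen_ext \<psi> b"
proof -
  define u :: "nat \<Rightarrow> ennreal" where "u i = (if i = 0 then a else 0)" for i
  \<comment> \<open>Infinite upper entries from index 2 on make every term whose \<open>S\<close>
    meets those indices equal to 0. Only subsets of \<open>{0, 1}\<close> survive, and for these the
    other coordinates contribute \<open>u i = 0\<close>.\<close>
  define v :: "nat \<Rightarrow> ennreal" where "v i = (if i = 0 then b else if i = 1 then c else \<infinity>)" for i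
  define G where "G S = gen_ext \<psi> (\<Sum>i<d. if i \<in> S then v i else u i)" for S
  have G: "G S = gen_ext \<psi> ((if 0 \<in> S then b else a) + (if 1 \<in> S then c else 0))" if "S \<subseteq> {0, 1}" for S
  proof -
    have "(\<Sum>i<d. if i \<in> S then v i else u i) = (\<Sum>i\<in>{0,1}. if i \<in> S then v i else u i)"
      using that assms(2) by (intro sum.mono_neutral_right) (auto simp: u_def)
    then show ?thesis
      by (simp add: G_def u_def v_def)
  qed
  have "G S = 0" if S: "S \<in> Pow {..<d} - Pow {0, 1}" for S
  proof -
    obtain i where i: "i < d" "i \<in> S" "i \<notin> {0, 1}"
      using S by blast
    have "(if i \<in> S then v i else u i) \<le> (\<Sum>i<d. if i \<in> S then v i else u i)"
      using i by (intro member_le_sum) auto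
    then show ?thesis
      using i by (simp add: G_def v_def gen_ext_def top_unique)
  qed
  then have "(\<Sum>S\<in>Pow {..<d}. (- 1) ^ card S * G S) = (\<Sum>S\<in>Pow {0, 1}. (- 1) ^ card S * G S)"
    using assms(2) by (intro sum.mono_neutral_right) auto
  also have "\<dots> = (\<Sum>S\<in>{{}, {0}, {1}, {0, 1}}. (- 1) ^ card S * G S)"
    by (intro sum.cong) auto
  also have "\<dots> = gen_ext \<psi> a - gen_ext \<psi> b - gen_ext \<psi> (a + c) + gen_ext \<psi> (b + c)"
    by (simp add: G)
  moreover have "0 \<le> (\<Sum>S\<in>Pow {..<d}. (- 1) ^ card S * G S)"
  proof -
    have "\<forall>i<d. u i \<le> v i"
      using assms(3) by (simp add: u_def v_def)
    then show ?thesis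
      using D by (simp add: difference_monotone_def G_def)
  qed
  ultimately show ?thesis
    by simp
qed

text \<open>By convexity a common summand never enlarges the gap between two values. The sums are
  compared by exchanging \<open>z i\<close> for \<open>w i\<close> one index at a time.\<close>

lemma gen_ext_sum_diff_le:
  assumes gen: "generator \<psi>" and D: "difference_monotone d \<psi>" and "d \<ge> 2" and "finite A"
  shows "\<bar>gen_ext \<psi> (\<Sum>i\<in>A. z i) - gen_ext \<psi> (\<Sum>i\<in>A. w i)\<bar>
    \<le> (\<Sum>i\<in>A. \<bar>gen_ext \<psi> (z i) - gen_ext \<psi> (w i)\<bar>)"
proof -
  have shift: "\<bar>gen_ext \<psi> (a + c) - gen_ext \<psi> (b + c)\<bar> \<le> \<bar>gen_ext \<psi> a - gen_ext \<psi> b\<bar>" for a b c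
  proof (induction a b rule: linorder_wlog)
    case (le a b)
    have "gen_ext \<psi> (b + c) \<le> gen_ext \<psi> (a + c)"
      using le by (intro gen_ext_antimono[OF gen] add_right_mono)
    then show ?case
      using difference_monotone_second_difference[OF D \<open>d \<ge> 2\<close> le, of c] by linarith
  qed (simp add: abs_minus_commute)
  show ?thesis
    using \<open>finite A\<close>
  proof (induction rule: finite_induct)
    case (insert i A)
    let ?Z = "\<Sum>i\<in>A. z i" and ?W = "\<Sum>i\<in>A. w i"
    have "\<bar>gen_ext \<psi> (z i + ?Z) - gen_ext \<psi> (w i + ?Z)\<bar> \<le> \<bar>gen_ext \<psi> (z i) - gen_ext \<psi> (w i)\<bar>"
      by (rule shift)
    moreover have "\<bar>gen_ext \<psi> (w i + ?Z) - gen_ext \<psi> (w i + ?W)\<bar> \<le> \<bar>gen_ext \<psi> ?Z - gen_ext \<psi> ?W\<bar>"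
      using shift[of ?Z "w i" ?W] by (simp add: add.commute)
    ultimately show ?case
      using insert by simp
  qed simp
qed

text \<open>With \<open>x i = \<xi> (z i)\<close> the left-hand side compares \<open>\<xi> (\<Sum>i. z i)\<close> with
  \<open>\<psi> (\<Sum>i. pseudo_inverse \<psi> (\<xi> (z i)))\<close>, so closeness of the pseudo-inverses is never needed.\<close>

lemma arch_fun_diff_le:
  assumes \<psi>: "generator \<psi>" "difference_monotone d \<psi>" and \<xi>: "generator \<xi>" and "d \<ge> 2"
    and close: "\<And>z. z \<ge> 0 \<Longrightarrow> \<bar>\<xi> z - \<psi> z\<bar> \<le> s" and x: "x \<in> unit_cube d"
  shows "\<bar>arch_fun d \<xi> x - arch_fun d \<psi> x\<bar> \<le> real (Suc d) * s"
proof -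
  have s: "s \<ge> 0"
    using close[of 0] by simp
  have ext: "\<bar>gen_ext \<xi> z - gen_ext \<psi> z\<bar> \<le> s" for z
    using close s by (simp add: gen_ext_def)
  define z where "z i = pseudo_inverse \<xi> (x i)" for i
  define w where "w i = pseudo_inverse \<psi> (x i)" for i
  have "\<bar>gen_ext \<psi> (z i) - gen_ext \<psi> (w i)\<bar> \<le> s" if "i < d" for i
  proof -
    have "x i \<in> {0..1}"
      using x that by (simp add: unit_cube_def PiE_iff)
    then have "gen_ext \<psi> (w i) = gen_ext \<xi> (z i)"
      unfolding z_def w_def by (simp only: gen_ext_pseudo_inverse[OF \<psi>(1)] gen_ext_pseudo_inverse[OF \<xi>])
    then show ?thesis
      using ext[of "z i"] by (simp add: abs_minus_commute)
  qed
  then have "(\<Sum>i<d. \<bar>gen_ext \<psi> (z i) - gen_ext \<psi> (w i)\<bar>) \<le> real d * s"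
    using sum_bounded_above[of "{..<d}" "\<lambda>i. \<bar>gen_ext \<psi> (z i) - gen_ext \<psi> (w i)\<bar>" s] by simp
  moreover have "\<bar>gen_ext \<psi> (\<Sum>i<d. z i) - gen_ext \<psi> (\<Sum>i<d. w i)\<bar>
      \<le> (\<Sum>i<d. \<bar>gen_ext \<psi> (z i) - gen_ext \<psi> (w i)\<bar>)"
    by (rule gen_ext_sum_diff_le[OF \<psi> \<open>d \<ge> 2\<close>]) simp
  moreover have "arch_fun d \<xi> x = gen_ext \<xi> (\<Sum>i<d. z i)" "arch_fun d \<psi> x = gen_ext \<psi> (\<Sum>i<d. w i)"
    using x by (simp_all add: arch_fun_def z_def w_def)
  \<comment> \<open>The \<open>d\<close> coordinates contribute \<open>s\<close> each, and replacing
    \<open>\<xi>\<close> by \<open>\<psi>\<close> at the sum of the \<open>z i\<close> contributes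
    one more \<open>s\<close>.\<close>
  ultimately show ?thesis
    using ext[of "\<Sum>i<d. z i"] by (simp add: algebra_simps)
qed

section \<open>Perturbation by the generator of the independence copula\<close>

text \<open>The base 1/2 gives the value 1/2 at 1, so convex combinations with a normalized
  generator stay normalized.\<close>

definition indep_gen :: "real \<Rightarrow> real" where
  "indep_gen z = (1 / 2) powr z"

lemma gen_ext_indep_gen_sum:
  "finite A \<Longrightarrow> gen_ext indep_gen (\<Sum>i\<in>A. z i) = (\<Prod>i\<in>A. gen_ext indep_gen (z i))"
proof (induction rule: finite_induct)
  case (insert i A)
  have "gen_ext indep_gen (a + b) = gen_ext indep_gen a * gen_ext indep_gen b" for a b
    by (cases a; cases b)
      (auto simp: gen_ext_def indep_gen_def powr_add simp flip: ennreal_plus)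
  then show ?case
    using insert by simp
qed (simp add: gen_ext_def indep_gen_def)

lemma gen_ext_indep_gen_antimono:
  "z \<le> w \<Longrightarrow> gen_ext indep_gen w \<le> gen_ext indep_gen z"
  by (auto simp: gen_ext_def indep_gen_def top_unique less_top[symmetric] intro!: powr_mono' enn2real_mono)

text \<open>The exponential turns sums into products, so the alternating sum factors into the
  differences of the values at \<open>u i\<close> and \<open>v i\<close>, each of which is
  nonnegative.\<close>

lemma difference_monotone_indep_gen: "difference_monotone d indep_gen"
  unfolding difference_monotone_def
proof (intro allI impI)
  fix u v :: "nat \<Rightarrow> ennreal"
  assume uv: "\<forall>i<d. u i \<le> v i"
  let ?e = "gen_ext indep_gen"
  have "(\<Sum>S\<in>Pow {..<d}. (- 1) ^ card S * ?e (\<Sum>i<d. if i \<in> S then v i else u i))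
      = (\<Sum>S\<in>Pow {..<d}. (- 1) ^ card S * (\<Prod>i\<in>S. ?e (v i)) * (\<Prod>i\<in>{..<d} - S. ?e (u i)))"
  proof (intro sum.cong refl)
    fix S assume "S \<in> Pow {..<d}"
    then have "{..<d} \<inter> {i. i \<in> S} = S" "{..<d} \<inter> - {i. i \<in> S} = {..<d} - S"
      by auto
    then show "(- 1) ^ card S * ?e (\<Sum>i<d. if i \<in> S then v i else u i)
        = (- 1) ^ card S * (\<Prod>i\<in>S. ?e (v i)) * (\<Prod>i\<in>{..<d} - S. ?e (u i))"
      by (simp add: gen_ext_indep_gen_sum if_distrib prod.If_cases)
  qed
  also have "\<dots> = (\<Prod>i<d. ?e (u i) - ?e (v i))"
    by (simp add: prod_diff_conv_sum)
  also have "0 \<le> \<dots>"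
    using uv by (intro prod_nonneg) (simp add: gen_ext_indep_gen_antimono)
  finally show "0 \<le> (\<Sum>S\<in>Pow {..<d}. (- 1) ^ card S * ?e (\<Sum>i<d. if i \<in> S then v i else u i))" .
qed

definition perturb :: "real \<Rightarrow> (real \<Rightarrow> real) \<Rightarrow> real \<Rightarrow> real" where
  "perturb s \<psi> z = (1 - s) * \<psi> z + s * indep_gen z"

lemma normalized_generator_perturb:
  assumes "normalized_generator \<psi>" "0 < s" "s \<le> 1"
  shows "normalized_generator (perturb s \<psi>)"
proof -
  have gen: "generator \<psi>" and one: "\<psi> 1 = 1 / 2"
    using assms by (auto simp: normalized_generator_def)
  have lim: "((\<lambda>z. (1 - s) * \<psi> z + s * indep_gen z) \<longlongrightarrow> (1 - s) * 0 + s * 0) at_top"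
  proof (intro tendsto_intros)
    show "(\<psi> \<longlongrightarrow> 0) at_top"
      using gen by (simp add: generator_def)
    show "(indep_gen \<longlongrightarrow> 0) at_top"
      unfolding indep_gen_def by real_asymp
  qed
  have range: "perturb s \<psi> z \<in> {0..1}" if "z \<ge> 0" for z
  proof -
    have "0 \<le> indep_gen z" "indep_gen z \<le> 1"
      using that powr_mono'[of 0 z "1 / 2"] by (auto simp: indep_gen_def)
    then show ?thesis
      using generator_range[OF gen that] assms convex_bound_le[of "\<psi> z" 1 "indep_gen z" "1 - s" s]
      by (simp add: perturb_def)
  qed
  have strict: "perturb s \<psi> y < perturb s \<psi> x" if "0 \<le> x" "x < y" for x y
  proof -
    have "(1 - s) * \<psi> y \<le> (1 - s) * \<psi> x"
      using generator_antimono[OF gen, of x y] that assms by (intro mult_left_mono) auto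
    moreover have "indep_gen y < indep_gen x"
      unfolding indep_gen_def using that by (intro powr_less_mono') auto
    ultimately show ?thesis
      using assms by (simp add: perturb_def add_le_less_mono)
  qed
  have "antimono_on {0..} (perturb s \<psi>)"
    using strict by (force simp: monotone_on_def order.order_iff_strict)
  moreover have "continuous_on {0..} (perturb s \<psi>)"
    using gen unfolding perturb_def indep_gen_def
    by (intro continuous_intros) (auto simp: generator_def)
  \<comment> \<open>The positive weight of \<open>indep_gen\<close> makes the perturbation strictly
    decreasing on all of \<open>{0..}\<close>, so the infimum in \<open>generator\<close> never has
    to be evaluated.\<close>
  moreover have "strict_antimono_on {z. 0 \<le> z \<and> P z} (perturb s \<psi>)" for P
    using strict by (auto simp: monotone_on_def)
  moreover have "(perturb s \<psi> \<longlongrightarrow> 0) at_top"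
    using lim by (simp add: perturb_def[abs_def])
  ultimately have "generator (perturb s \<psi>)"
    using range gen by (auto simp: generator_def perturb_def indep_gen_def)
  then show ?thesis
    using one by (simp add: normalized_generator_def perturb_def indep_gen_def field_simps)
qed

text \<open>Alternating differences are linear in the generator, so their nonnegativity passes to
  convex combinations.\<close>

lemma difference_monotone_perturb:
  assumes "difference_monotone d \<psi>" "0 \<le> s" "s \<le> 1"
  shows "difference_monotone d (perturb s \<psi>)"
  unfolding difference_monotone_def
proof (intro allI impI)
  fix u v :: "nat \<Rightarrow> ennreal"
  assume uv: "\<forall>i<d. u i \<le> v i"
  let ?D = "\<lambda>\<psi>. \<Sum>S\<in>Pow {..<d}. (- 1) ^ card S * gen_ext \<psi> (\<Sum>i<d. if i \<in> S then v i else u i)"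
  have "gen_ext (perturb s \<psi>) z = (1 - s) * gen_ext \<psi> z + s * gen_ext indep_gen z" for z
    by (simp add: gen_ext_def perturb_def)
  then have "?D (perturb s \<psi>) = (1 - s) * ?D \<psi> + s * ?D indep_gen"
    by (simp only: sum_distrib_left sum.distrib[symmetric] distrib_left mult.left_commute)
  moreover have "?D \<psi> \<ge> 0" "?D indep_gen \<ge> 0"
    using assms difference_monotone_indep_gen uv unfolding difference_monotone_def by blast+
  ultimately show "0 \<le> ?D (perturb s \<psi>)"
    using assms by simp
qed

lemma perturb_diff_le:
  assumes "generator \<psi>" "0 \<le> s" "z \<ge> 0"
  shows "\<bar>perturb s \<psi> z - \<psi> z\<bar> \<le> s"
proof -
  have "0 \<le> indep_gen z" "indep_gen z \<le> 1"
    using assms powr_mono'[of 0 z "1 / 2"] by (auto simp: indep_gen_def)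
  then have "\<bar>indep_gen z - \<psi> z\<bar> \<le> 1"
    using generator_range[OF assms(1,3)] by auto
  then have "s * \<bar>indep_gen z - \<psi> z\<bar> \<le> s"
    using assms by (simp add: mult_left_le)
  moreover have "perturb s \<psi> z - \<psi> z = s * (indep_gen z - \<psi> z)"
    by (simp add: perturb_def algebra_simps)
  ultimately show ?thesis
    using assms by (simp add: abs_mult)
qed

section \<open>Strictness and positivity on the diagonal\<close>

lemma arch_fun_pos:
  assumes gen: "generator \<psi>" and pos: "\<And>z. z \<ge> 0 \<Longrightarrow> \<psi> z > 0"
    and x: "x \<in> unit_cube d" "\<And>i. i < d \<Longrightarrow> x i > 0"
  shows "arch_fun d \<psi> x > 0"
proof -
  \<comment> \<open>At \<open>\<infinity>\<close> the extension is 0, so a positive coordinate has a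
    finite pseudo-inverse; a finite sum of these is finite, where \<open>\<psi>\<close> is
    positive.\<close>
  have "pseudo_inverse \<psi> (x i) \<noteq> \<infinity>" if "i < d" for i
  proof -
    have "gen_ext \<psi> (pseudo_inverse \<psi> (x i)) > 0"
      using gen_ext_pseudo_inverse[OF gen] x that by (auto simp: unit_cube_def PiE_iff)
    then show ?thesis
      by (auto simp: gen_ext_def)
  qed
  then have "(\<Sum>i<d. pseudo_inverse \<psi> (x i)) \<noteq> \<infinity>"
    by (simp add: sum_Pinfty ennreal_sum_eq_top)
  then show ?thesis
    using x pos by (simp add: arch_fun_def gen_ext_def)
qed

lemma nonstrict_arch_fun_zero:
  assumes gen: "generator \<psi>" and "\<not> strict_generator \<psi>" "d \<ge> 2"
  obtains k :: nat where "arch_fun d \<psi> (\<lambda>i\<in>{..<d}. 1 / real (Suc k)) = 0"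
proof -
  have "\<exists>z\<ge>0. \<psi> z = 0"
  proof (rule ccontr)
    assume "\<not> ?thesis"
    then have "{z. gen_ext \<psi> z = 0} = {\<infinity>}"
      by (auto simp: gen_ext_def)
    with assms(2) show False
      by (simp add: strict_generator_def pseudo_inverse_def)
  qed
  then obtain z0 where z0: "z0 > 0" "\<psi> z0 = 0" "\<And>z. z \<ge> 0 \<Longrightarrow> \<psi> z = 0 \<Longrightarrow> z0 \<le> z"
    by (metis generator_least_zero[OF gen])
  have "\<psi> (z0 / 2) \<noteq> 0"
    using z0(1) z0(3)[of "z0 / 2"] by auto
  then have pos: "\<psi> (z0 / 2) > 0"
    using generator_range[OF gen, of "z0 / 2"] z0(1) by auto
  \<comment> \<open>Below the level \<open>\<psi> (z0 / 2)\<close> every pseudo-inverse is at least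
    half of the first zero \<open>z0\<close>, so two coordinates already bring the sum to
    \<open>z0\<close>.\<close>
  obtain k where k: "1 / real (Suc k) < \<psi> (z0 / 2)"
    using reals_Archimedean[OF pos] by (auto simp: inverse_eq_divide)
  define q where "q = 1 / real (Suc k)"
  have q: "q \<in> {0..1}" "q \<le> \<psi> (z0 / 2)"
    using k by (auto simp: q_def)
  have ext: "gen_ext \<psi> (ennreal (z0 / 2)) = \<psi> (z0 / 2)"
    using z0(1) by (simp add: gen_ext_def)
  have "ennreal (z0 / 2) = pseudo_inverse \<psi> (\<psi> (z0 / 2))"
    using pseudo_inverse_gen_ext[OF gen, of "ennreal (z0 / 2)"] pos unfolding ext by simp
  also have "\<dots> \<le> pseudo_inverse \<psi> q"
    using q generator_range[OF gen, of "z0 / 2"] z0(1)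
    by (intro pseudo_inverse_antimono[OF gen]) auto
  finally have half: "ennreal (z0 / 2) \<le> pseudo_inverse \<psi> q" .
  have "ennreal z0 = ennreal (z0 / 2 + z0 / 2)"
    by simp
  also have "\<dots> = ennreal (z0 / 2) + ennreal (z0 / 2)"
    using z0(1) by (intro ennreal_plus) auto
  also have "\<dots> \<le> pseudo_inverse \<psi> q + pseudo_inverse \<psi> q"
    by (intro add_mono half)
  also have "\<dots> = (\<Sum>i\<in>{0, 1 :: nat}. pseudo_inverse \<psi> q)"
    by (simp add: mult_2)
  also have "\<dots> \<le> (\<Sum>i<d. pseudo_inverse \<psi> q)"
    using \<open>d \<ge> 2\<close> by (intro sum_mono2) auto
  finally have "gen_ext \<psi> (\<Sum>i<d. pseudo_inverse \<psi> q) \<le> gen_ext \<psi> (ennreal z0)"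
    by (rule gen_ext_antimono[OF gen])
  also have "\<dots> = 0"
    using z0 by (simp add: gen_ext_def)
  finally have "gen_ext \<psi> (\<Sum>i<d. pseudo_inverse \<psi> q) = 0"
    using gen_ext_range(1)[OF gen] by (intro antisym)
  moreover have "(\<lambda>i\<in>{..<d}. q) \<in> unit_cube d"
    using q by (auto simp: unit_cube_def)
  ultimately have "arch_fun d \<psi> (\<lambda>i\<in>{..<d}. q) = 0"
    by (simp add: arch_fun_def)
  then show ?thesis
    unfolding q_def by (rule that)
qed

section \<open>Point evaluations and convergence in the uniform metric\<close>

lemma abs_diff_le_mdist_arch_copula_metric:
  assumes "A \<in> arch_copulas d" "B \<in> arch_copulas d" "x \<in> unit_cube d"
  shows "\<bar>A x - B x\<bar> \<le> mdist (arch_copula_metric d) A B"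
  unfolding mdist_arch_copula_metric[OF assms(1,2)]
proof (rule cSUP_upper[OF assms(3), of "\<lambda>x. \<bar>A x - B x\<bar>"])
  \<comment> \<open>Values in \<open>{0..1}\<close> keep the supremum bounded, which a real-valued
    \<open>SUP\<close> needs in order to dominate its members.\<close>
  have "C x \<in> {0..1}" if "C \<in> arch_copulas d" "x \<in> unit_cube d" for C x
    using that by (simp add: arch_copulas_def copula_def PiE_iff)
  from this[OF assms(1)] this[OF assms(2)]
  have "\<bar>A x - B x\<bar> \<le> 1" if "x \<in> unit_cube d" for x
    using that by fastforce
  then show "bdd_above ((\<lambda>x. \<bar>A x - B x\<bar>) ` unit_cube d)"
    by (rule bdd_aboveI2)
qed

lemma limitin_mtopology_ofI:
  assumes "x \<in> mspace m" "\<And>n. p n \<in> mspace m" and "b \<longlonglongrightarrow> 0"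
    and "\<And>n. mdist m (p n) x \<le> b n"
  shows "limitin (mtopology_of m) p x sequentially"
proof -
  interpret Metric_space "mspace m" "mdist m"
    by simp
  have "\<forall>\<^sub>F n in sequentially. mdist m (p n) x < e" if "e > 0" for e
    using order_tendstoD(2)[OF assms(3) that] by eventually_elim (use assms(4) le_less_trans in blast)
  then show ?thesis
    using assms(1,2) by (simp add: mtopology_of_def limitin_metric)
qed

theorem comeager_strict_arch_copulas:
  assumes "d \<ge> 2"
  shows "comeager_in (mtopology_of (arch_copula_metric d)) (strict_arch_copulas d)"
proof -
  define q :: "nat \<Rightarrow> nat \<Rightarrow> real" where "q k = (\<lambda>i\<in>{..<d}. 1 / real (Suc k))" for k
  have q: "q k \<in> unit_cube d" for k
    by (auto simp: q_def unit_cube_def)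
  have space: "mspace (arch_copula_metric d) = arch_copulas d"
    by (rule mspace_arch_copula_metric)
  show ?thesis
  proof (rule comeager_inI[where f = "\<lambda>k C. C (q k)"]; (unfold topspace_mtopology_of space)?)
    show "strict_arch_copulas d \<subseteq> arch_copulas d"
      by (auto simp: strict_arch_copulas_def arch_copulas_def)
  next
    fix k
    have "Lipschitz_continuous_map (arch_copula_metric d) euclidean_metric (\<lambda>C. C (q k))"
      unfolding Lipschitz_continuous_map_def space
      using abs_diff_le_mdist_arch_copula_metric[OF _ _ q]
      by (auto simp: dist_real_def intro!: exI[of _ 1])
    then show "continuous_map (mtopology_of (arch_copula_metric d)) euclideanreal (\<lambda>C. C (q k))"
      using Lipschitz_continuous_imp_continuous_map by fastforce
  next
    fix k C assume C: "C \<in> arch_copulas d"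
    then obtain \<psi> where \<psi>: "normalized_generator \<psi>" "C = arch_fun d \<psi>" and "copula d C"
      by (auto simp: arch_copulas_def)
    then have gen: "generator \<psi>" and mono: "difference_monotone d \<psi>"
      using copula_arch_fun_iff by (auto simp: normalized_generator_def)
    define s where "s n = 1 / real (Suc n)" for n
    have s: "0 < s n" "s n \<le> 1" for n
      by (auto simp: s_def)
    have norm: "normalized_generator (perturb (s n) \<psi>)" for n
      by (rule normalized_generator_perturb[OF \<psi>(1) s])
    then have gen': "generator (perturb (s n) \<psi>)" for n
      by (simp add: normalized_generator_def)
    \<comment> \<open>The approximating copulas come from mixing the generators, not the copulas: a
      convex combination of Archimedean copulas need not be Archimedean.\<close>
    define p where "p n = arch_fun d (perturb (s n) \<psi>)" for n
    have p: "p n \<in> arch_copulas d" for n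
      using norm copula_arch_fun_iff[OF gen'] difference_monotone_perturb[OF mono] s
      by (auto simp: arch_copulas_def p_def less_imp_le)
    have dist: "mdist (arch_copula_metric d) (p n) C \<le> real (Suc d) * s n" for n
      unfolding mdist_arch_copula_metric[OF p C]
    proof (rule cSUP_least)
      show "\<bar>p n x - C x\<bar> \<le> real (Suc d) * s n" if "x \<in> unit_cube d" for x
        unfolding p_def \<psi>(2)
        by (rule arch_fun_diff_le[OF gen mono gen' assms perturb_diff_le[OF gen] that])
          (use s in \<open>auto simp: less_imp_le\<close>)
    qed (use q in blast)
    have "(\<lambda>n. real (Suc d) * s n) \<longlonglongrightarrow> real (Suc d) * 0"
      unfolding s_def by (intro tendsto_intros LIMSEQ_Suc lim_1_over_n)
    then have "limitin (mtopology_of (arch_copula_metric d)) p C sequentially"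
      using C p by (intro limitin_mtopology_ofI[OF _ _ _ dist]) (auto simp: space)
    moreover have "p n (q k) > 0" for n
      unfolding p_def
    proof (rule arch_fun_pos[OF gen' _ q])
      \<comment> \<open>Positivity comes from the \<open>indep_gen\<close> part, whose weight
        \<open>s n\<close> is positive; \<open>\<psi>\<close> itself may vanish at
        \<open>z\<close>.\<close>
      show "perturb (s n) \<psi> z > 0" if "z \<ge> 0" for z
        using generator_range[OF gen that] s
        by (auto simp: perturb_def indep_gen_def intro!: add_nonneg_pos)
    qed (simp add: q_def)
    ultimately show "\<exists>p. limitin (mtopology_of (arch_copula_metric d)) p C sequentially
        \<and> (\<forall>n. p n (q k) \<noteq> 0)"
      by (metis less_irrefl)
  next
    fix C assume "C \<in> arch_copulas d - strict_arch_copulas d"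
    \<comment> \<open>A single strict normalized generator would make \<open>C\<close> strict, so
      whichever normalized generator represents \<open>C\<close> is nonstrict.\<close>
    then obtain \<psi> where "generator \<psi>" "\<not> strict_generator \<psi>" "C = arch_fun d \<psi>"
      by (auto simp: arch_copulas_def strict_arch_copulas_def normalized_generator_def)
    then show "\<exists>k. C (q k) = 0"
      using nonstrict_arch_fun_zero[OF _ _ assms] unfolding q_def by metis
  qed
qed

theorem corollary6p5:
  fixes d :: nat
  assumes "d \<ge> 2"
  shows "comeager_in (subtopology (weak_topology {0..}) (P_W d)) (P_W_s d) \<and>
         comeager_in (mtopology_of (arch_copula_metric d)) (strict_arch_copulas d)"
  using comeager_P_W_s[OF assms] comeager_strict_arch_copulas[OF assms] ..

end
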